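(* Let $(F_n)_{n\ge0}$ be the Fibonacci sequence with $F_0=1$, $F_1=2$, $F_n=F_{n-1}+F_{n-2}$. The only powers of two whose Zeckendorf expansion has exactly three non-zero digits (summands) are $32,64,128,256$ and $1024$. Moreover, there is no power of two whose Zeckendorf expansion has exactly four non-zero digits.
   Context: The Zeckendorf expansion of a positive integer $n$ is its unique representation $n=F_{n_1}+\dots+F_{n_k}$ with $n_1>\dots>n_k\ge0$ and $n_i-n_{i+1}\ge2$ for all $i$; its number of non-zero digits is $k$. *)

theory Defs
  imports Main "HOL-Number_Theory.Fib"
begin

text \<open>The library sequence \<^const>\<open>fib\<close> starts with 0, 1, 1, 2, so it has to be shifted by two.\<close>

definition F :: "nat \<Rightarrow> nat" where
  "F n = fib (n + 2)"

lemma F_0: "F 0 = 1"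
  by (simp add: F_def numeral_2_eq_2)

lemma F_1: "F 1 = 2"
  by (simp add: F_def numeral_2_eq_2)

lemma F_rec: "n \<ge> 2 \<Longrightarrow> F n = F (n - 1) + F (n - 2)"
  by (cases n rule: fib.cases) (simp_all add: F_def)

lemma F_Suc_Suc: "F (Suc (Suc n)) = F (Suc n) + F n"
  by (simp add: F_def)

text \<open>An expansion is the list of its indices, largest first.\<close>

definition is_zeckendorf :: "nat \<Rightarrow> nat list \<Rightarrow> bool" where
  "is_zeckendorf n ns \<longleftrightarrow> n = (\<Sum>i\<leftarrow>ns. F i) \<and> successively (\<lambda>i j. i \<ge> j + 2) ns"

definition zeckendorf :: "nat \<Rightarrow> nat list" where
  "zeckendorf n = (THE ns. is_zeckendorf n ns)"

definition zeckendorf_digits :: "nat \<Rightarrow> nat" where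
  "zeckendorf_digits n = length (zeckendorf n)"

lemma F_pos: "F n > 0"
  by (simp add: F_def fib_neq_0_nat)

lemma F_mono: "m \<le> n \<Longrightarrow> F m \<le> F n"
  unfolding F_def by (rule fib_mono) simp

lemma F_gt: "n < F n"
proof (induction n rule: less_induct)
  case (less n)
  consider "n = 0" | "n = 1" | m where "n = Suc (Suc m)"
    by (metis One_nat_def not0_implies_Suc)
  then show ?case
  proof cases
    case 3
    then have "Suc m < F (Suc m)" "m < F m" using less by auto
    then show ?thesis using 3 by (simp add: F_Suc_Suc)
  qed (use F_0 F_1 in auto)
qed

lemma is_zeckendorf_Cons:
  "is_zeckendorf n (k # ns) \<longleftrightarrow>
     F k \<le> n \<and> is_zeckendorf (n - F k) ns \<and> (ns = [] \<or> hd ns + 2 \<le> k)"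
  by (cases ns) (auto simp: is_zeckendorf_def)

lemma is_zeckendorf_less: "is_zeckendorf n (k # ns) \<Longrightarrow> n < F (Suc k)"
proof (induction ns arbitrary: n k)
  case Nil
  then have "n = F k" by (simp add: is_zeckendorf_def)
  then show ?case
    using F_0 F_1 F_pos by (cases k) (auto simp: F_Suc_Suc)
next
  case (Cons j js)
  have 1: "F k \<le> n" "is_zeckendorf (n - F k) (j # js)" "j + 2 \<le> k"
    using Cons.prems by (simp_all add: is_zeckendorf_Cons[of n])
  then have "n - F k < F (Suc j)" using Cons.IH by blast
  also have "\<dots> \<le> F (k - 1)" using 1 by (intro F_mono) simp
  finally have "n < F k + F (k - 1)" using 1 by linarith
  also have "\<dots> = F (Suc k)" using F_rec[of "Suc k"] 1(3) by simp
  finally show ?case .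
qed

lemma is_zeckendorf_0: "is_zeckendorf 0 ns \<longleftrightarrow> ns = []"
  using F_pos by (cases ns) (auto simp: is_zeckendorf_def)

lemma is_zeckendorf_exists: "\<exists>ns. is_zeckendorf n ns"
proof (induction n rule: less_induct)
  case (less n)
  show ?case
  proof (cases "n = 0")
    case True
    then show ?thesis using is_zeckendorf_0 by blast
  next
    case False
    define k where "k = (GREATEST k. F k \<le> n)"
    have bnd: "y \<le> n" if "F y \<le> n" for y using F_gt[of y] that by simp
    have F0: "F 0 \<le> n" using False F_0 by simp
    have k: "F k \<le> n" unfolding k_def by (rule GreatestI_nat[of "\<lambda>k. F k \<le> n", OF F0 bnd])
    have "\<not> F (Suc k) \<le> n"
      using Greatest_le_nat[of "\<lambda>k. F k \<le> n" "Suc k" n] bnd unfolding k_def by force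
    then have lt: "n < F (Suc k)" by simp
    obtain ns where ns: "is_zeckendorf (n - F k) ns"
      using less[of "n - F k"] F_pos[of k] False by auto
    have "hd ns + 2 \<le> k" if ne: "ns \<noteq> []"
    proof -
      obtain j js where j: "ns = j # js" using ne by (cases ns) auto
      then have le: "F j \<le> n - F k" using ns by (simp add: is_zeckendorf_Cons)
      have "k \<noteq> 0" using lt le F_0 F_1 F_pos[of j] by (cases k) auto
      then have "F (Suc k) = F k + F (k - 1)" using F_rec[of "Suc k"] by simp
      then have "F j < F (k - 1)" using le lt k by linarith
      then have "j < k - 1" using F_mono[of "k - 1" j] by linarith
      then show ?thesis using j by simp
    qed
    then have "is_zeckendorf n (k # ns)"
      using ns k by (auto simp: is_zeckendorf_Cons)
    then show ?thesis by blast
  qed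
qed

lemma is_zeckendorf_unique:
  "is_zeckendorf n ns \<Longrightarrow> is_zeckendorf n ms \<Longrightarrow> ns = ms"
proof (induction ns arbitrary: n ms)
  case Nil
  then show ?case using is_zeckendorf_0 by (auto simp: is_zeckendorf_def[of _ "[]"])
next
  case (Cons k ns)
  have "n \<noteq> 0" using Cons.prems is_zeckendorf_0 by (metis list.distinct(1))
  then obtain j js where ms: "ms = j # js"
    using Cons.prems(2) by (cases ms) (auto simp: is_zeckendorf_def)
  have "F k \<le> n" "n < F (Suc k)" "F j \<le> n" "n < F (Suc j)"
    using Cons.prems ms is_zeckendorf_less by (auto simp: is_zeckendorf_Cons)
  then have "F k < F (Suc j)" "F j < F (Suc k)" by linarith+
  then have "k = j" using F_mono[of "Suc j" k] F_mono[of "Suc k" j] by linarith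
  then show ?case using Cons ms by (auto simp: is_zeckendorf_Cons)
qed

lemma is_zeckendorf_ex1: "\<exists>!ns. is_zeckendorf n ns"
  using is_zeckendorf_exists is_zeckendorf_unique by blast

lemma zeckendorf_eq_iff: "zeckendorf n = ns \<longleftrightarrow> is_zeckendorf n ns"
  unfolding zeckendorf_def using is_zeckendorf_ex1 by (metis theI')

end

theory Submission imports Defs "HOL-Number_Theory.Cong" "HOL-Library.Multiset" begin

text \<open>
  Neither 3 nor 4 digits occur for exponents $a \ge 11$ because $2^a$ is then not a sum of four
  Fibonacci numbers (zero included). Modulo $m$ that equation depends only on the four indices
  modulo a period $N$ and on $a$ modulo a period $M$. The periods are refined step by step, up to
  $N = 15360$ and $M = 38400$, and after each step the residue classes are tested modulo some $m$
  having these periods. No class survives. The classes of genuine solutions such as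
  $1024 = 987 + 34 + 3$ are ruled out only modulo $2^{11}$.
\<close>

subsection \<open>Residues of Fibonacci numbers and of powers of two\<close>

definition fibr :: "int \<Rightarrow> nat \<Rightarrow> int" where
  "fibr m n = int (fib n) mod m"

text \<open>The offset 11 makes $2^{11}$ a modulus with period 1 for the powers of two.\<close>

definition twor :: "int \<Rightarrow> nat \<Rightarrow> int" where
  "twor m a = 2 ^ (a + 11) mod m"

lemma fib_add_Suc: "fib (n + Suc k) = fib (Suc k) * fib (Suc n) + fib k * fib n"
  using fib_add[of n k] by simp

text \<open>For positive \<open>n\<close> the addition formula gives \<open>fib (n + N)\<close> as
  \<open>fib (N + 1) * fib n + fib N * fib (n - 1)\<close>, so the residues 1 and 0 at
  \<open>N + 1\<close> and \<open>N\<close> reproduce \<open>fib n\<close>.\<close>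

lemma fibr_period:
  assumes "fibr m N = 0" "fibr m (N + 1) = 1"
  shows "fibr m (n + N) = fibr m n"
proof (cases n)
  case 0
  then show ?thesis using assms by (simp add: fibr_def)
next
  case (Suc n')
  have "[int (fib N) = 0] (mod m)" "[int (fib (Suc N)) = 1] (mod m)"
    using assms by (auto simp: fibr_def cong_def) (metis mod_mod_trivial)+
  then have "[int (fib (Suc N)) * int (fib n) + int (fib N) * int (fib n') = 1 * int (fib n) + 0 * int (fib n')] (mod m)"
    by (intro cong_add cong_mult cong_refl)
  moreover have "int (fib (n + N)) = int (fib (Suc N)) * int (fib n) + int (fib N) * int (fib n')"
    using fib_add[of n' N] Suc by (simp flip: of_nat_mult of_nat_add)
  ultimately show ?thesis by (simp add: fibr_def cong_def)
qed

lemma periodic_cong: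
  fixes f :: "nat \<Rightarrow> 'a"
  assumes "\<And>n. f (n + N) = f n" "[x = y] (mod N)"
  shows "f x = f y"
proof -
  have *: "f (n + N * k) = f n" for n k
  proof (induction k)
    case (Suc k)
    have "f (n + N * Suc k) = f (n + N * k + N)" by (simp add: algebra_simps)
    then show ?case using Suc assms(1) by simp
  qed simp
  obtain k l where "x + N * k = y + N * l"
    using assms(2) by (metis cong_iff_lin_nat mult.commute)
  then show ?thesis using * by metis
qed

lemma fibr_cong:
  assumes "fibr m N = 0" "fibr m (N + 1) = 1" "[x = y] (mod N)"
  shows "fibr m x = fibr m y"
  using periodic_cong[of "fibr m" N] fibr_period[OF assms(1,2)] assms(3) by blast

text \<open>Multiplying the congruence between \<open>2 ^ (M + 11)\<close> and \<open>2 ^ 11\<close>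
  by \<open>2 ^ n\<close> carries the period to every exponent. This stays valid for even
  \<open>m\<close>, where 2 has no inverse.\<close>

lemma twor_cong:
  assumes "twor m M = twor m 0" "[x = y] (mod M)"
  shows "twor m x = twor m y"
proof (rule periodic_cong[OF _ assms(2)])
  fix n
  have "[(2::int) ^ n * 2 ^ (M + 11) = 2 ^ n * 2 ^ 11] (mod m)"
    using assms(1) by (intro cong_scalar_left) (simp add: twor_def cong_def)
  then show "twor m (n + M) = twor m n"
    by (simp add: twor_def cong_def power_add mult_ac)
qed

text \<open>Modulo the period, \<open>(N - 1) * n\<close> is the index \<open>-n\<close>. The
  addition formulas at \<open>y + n\<close> and \<open>y + n + 1\<close> form a linear system for
  the residues at \<open>y\<close> and \<open>y + 1\<close>; by Cassini's identity its determinant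
  is 1 for odd \<open>n\<close>.\<close>

lemma fibr_reflect:
  assumes "fibr m N = 0" "fibr m (N + 1) = 1" "N > 0" "odd n"
  shows "fibr m ((N - 1) * n) = fibr m n"
proof -
  obtain k where n: "n = Suc k" using \<open>odd n\<close> by (cases n) auto
  define y where "y = (N - 1) * n"
  define u w a b c where "u = int (fib y)" and "w = int (fib (Suc y))" and "a = int (fib n)"
    and "b = int (fib (Suc n))" and "c = int (fib k)"
  have yn: "y + n = N * n" using \<open>N > 0\<close> by (cases N) (simp_all add: y_def)
  have "[y + n = 0] (mod N)" by (simp add: yn cong_0_iff)
  moreover from this have "[y + n + 1 = 0 + 1] (mod N)" by (rule cong_add[OF _ cong_refl])
  ultimately have "fibr m (y + n) = fibr m 0" "fibr m (y + n + 1) = fibr m (0 + 1)"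
    using fibr_cong[OF assms(1,2)] by blast+
  then have "fibr m (y + n) = fibr m 0" "fibr m (Suc (y + n)) = fibr m 1" by simp_all
  moreover have "int (fib (y + n)) = a * w + c * u"
    unfolding n fib_add_Suc by (simp add: a_def w_def c_def u_def n)
  moreover have "int (fib (Suc (y + n))) = b * w + a * u"
    unfolding fib_add by (simp add: a_def w_def b_def u_def)
  ultimately have 1: "[a * w + c * u = 0] (mod m)" "[b * w + a * u = 1] (mod m)"
    by (auto simp: fibr_def cong_def)
  have "b * c - a\<^sup>2 = - ((-1) ^ k)"
    using fib_Cassini_int[of k] by (simp add: a_def b_def c_def n)
  then have 2: "a * a - b * c = 1"
    using \<open>odd n\<close> by (simp add: n power2_eq_square)
  \<comment> \<open>This combination of the two congruences eliminates \<open>w\<close>.\<close>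
  have "[a * (b * w + a * u) - b * (a * w + c * u) = a * 1 - b * 0] (mod m)"
    by (intro cong_diff cong_mult cong_refl 1)
  moreover have "a * (b * w + a * u) - b * (a * w + c * u) = (a * a - b * c) * u"
    by (simp add: algebra_simps)
  ultimately have "[u = a] (mod m)" by (simp add: 2)
  then show ?thesis by (simp add: fibr_def cong_def u_def a_def y_def)
qed

text \<open>For arguments already reduced modulo \<open>m\<close>, one comparison replaces a
  division, which keeps evaluation by rewriting cheap.\<close>

definition addm :: "int \<Rightarrow> int \<Rightarrow> int \<Rightarrow> int" where
  "addm m x y = (if x + y < m then x + y else x + y - m)"

definition subm :: "int \<Rightarrow> int \<Rightarrow> int \<Rightarrow> int" where
  "subm m x y = (if y \<le> x then x - y else x + m - y)"

lemma addm_mod: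
  assumes "0 < m"
  shows "addm m (x mod m) (y mod m) = (x + y) mod m"
proof -
  have *: "addm m x' y' = (x' + y') mod m" if "0 \<le> x'" "x' < m" "0 \<le> y'" "y' < m" for x' y'
  proof (cases "x' + y' < m")
    case False
    have "(x' + y') mod m = (x' + y' - m) mod m" by simp
    also have "\<dots> = x' + y' - m" using False that by (intro mod_pos_pos_trivial) auto
    finally show ?thesis using False by (simp add: addm_def)
  qed (use that in \<open>simp add: addm_def\<close>)
  show ?thesis using assms by (simp add: * mod_add_eq)
qed

lemma subm_mod:
  assumes "0 < m"
  shows "subm m (x mod m) (y mod m) = (x - y) mod m"
proof -
  have *: "subm m x' y' = (x' - y') mod m" if "0 \<le> x'" "x' < m" "0 \<le> y'" "y' < m" for x' y'
    using that mod_add_self2[of "x' - y'" m]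
    by (cases "y' \<le> x'") (simp_all add: subm_def mod_pos_pos_trivial algebra_simps)
  show ?thesis using assms by (simp add: * mod_diff_eq)
qed

subsection \<open>The sieve\<close>

text \<open>
  The functions below are evaluated by the simplifier. They are tail recursive with small arguments,
  and a class of quadruples is tested through the sums of its two halves.
\<close>

fun shifts :: "nat list \<Rightarrow> nat \<Rightarrow> nat list" where
  "shifts [] n = []"
| "shifts (e # es) n = (n + e) # shifts es n"

fun sums_with :: "int \<Rightarrow> nat \<Rightarrow> int \<Rightarrow> nat list \<Rightarrow> (int \<times> nat \<times> nat) list \<Rightarrow> (int \<times> nat \<times> nat) list" where
  "sums_with m x r [] acc = acc"
| "sums_with m x r (y # ys) acc = sums_with m x r ys ((addm m r (fibr m y), x, y) # acc)"

fun pair_sums :: "int \<Rightarrow> nat list \<Rightarrow> nat list \<Rightarrow> (int \<times> nat \<times> nat) list \<Rightarrow> (int \<times> nat \<times> nat) list" where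
  "pair_sums m [] ys acc = acc"
| "pair_sums m (x # xs) ys acc = pair_sums m xs ys (sums_with m x (fibr m x) ys acc)"

type_synonym node = "nat \<times> nat \<times> nat \<times> nat \<times> nat"
type_synonym level = "nat list \<times> nat list \<times> int"

fun hits :: "int \<Rightarrow> nat \<Rightarrow> nat \<Rightarrow> nat \<Rightarrow> (int \<times> nat \<times> nat) list \<Rightarrow> node list \<Rightarrow> node list" where
  "hits d x y s [] acc = acc"
| "hits d x y s ((v, z, w) # l) acc =
     (if v = d then hits d x y s l ((x, y, z, w, s) # acc) else hits d x y s l acc)"

fun hits_pairs :: "int \<Rightarrow> nat \<Rightarrow> int \<Rightarrow> (int \<times> nat \<times> nat) list \<Rightarrow> (int \<times> nat \<times> nat) list \<Rightarrow> node list \<Rightarrow> node list" where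
  "hits_pairs m s g [] l acc = acc"
| "hits_pairs m s g ((u, x, y) # k) l acc = hits_pairs m s g k l (hits (subm m g u) x y s l acc)"

fun survivors :: "int \<Rightarrow> nat list \<Rightarrow> (int \<times> nat \<times> nat) list \<Rightarrow> (int \<times> nat \<times> nat) list \<Rightarrow> node list \<Rightarrow> node list" where
  "survivors m [] k l acc = acc"
| "survivors m (s # ss) k l acc = survivors m ss k l (hits_pairs m s (twor m s) k l acc)"

text \<open>A node holds four index classes and an exponent class modulo the current periods. Each
  lift that passes the test modulo \<open>m\<close> must be refuted by the later levels; a class
  left when the levels run out has survived, hence \<open>False\<close>.\<close>

fun refutes :: "level list \<Rightarrow> node \<Rightarrow> bool" and refutes_all :: "level list \<Rightarrow> node list \<Rightarrow> bool" where
  "refutes [] v = False"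
| "refutes ((q, r, m) # ls) (n1, n2, n3, n4, a) =
     refutes_all ls (survivors m (shifts r a)
       (pair_sums m (shifts q n1) (shifts q n2) []) (pair_sums m (shifts q n3) (shifts q n4) []) [])"
| "refutes_all ls [] = True"
| "refutes_all ls (v # vs) = (if refutes ls v then refutes_all ls vs else False)"

fun refutes_list :: "level list \<Rightarrow> nat list \<Rightarrow> bool" where
  "refutes_list ls [n1, n2, n3, n4] = refutes ls (n1, n2, n3, n4, 0)"
| "refutes_list ls _ = False"

text \<open>The equation is symmetric in its indices, so only multisets of classes are enumerated;
  \<open>c\<close> stays available after being chosen, which allows repetitions.\<close>

fun search :: "level list \<Rightarrow> nat \<Rightarrow> nat list \<Rightarrow> nat list \<Rightarrow> bool" where
  "search ls 0 ns cs = refutes_list ls ns"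
| "search ls (Suc k) ns [] = True"
| "search ls (Suc k) ns (c # cs) =
     (if search ls k (c # ns) (c # cs) then search ls (Suc k) ns cs else False)"

section \<open>The sieve functions described as sets\<close>

lemma set_shifts: "set (shifts es n) = (\<lambda>e. n + e) ` set es"
  by (induction es) auto

lemma set_sums_with: "set (sums_with m x r ys acc) = (\<lambda>y. (addm m r (fibr m y), x, y)) ` set ys \<union> set acc"
  by (induction ys arbitrary: acc) auto

lemma set_pair_sums:
  "set (pair_sums m xs ys acc) =
     (\<lambda>(x, y). (addm m (fibr m x) (fibr m y), x, y)) ` (set xs \<times> set ys) \<union> set acc"
  by (induction xs arbitrary: acc) (auto simp: set_sums_with)

lemma set_hits: "set (hits d x y s l acc) = {(x, y, z, w, s) | z w. (d, z, w) \<in> set l} \<union> set acc"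
  by (induction d x y s l acc rule: hits.induct) auto

lemma set_hits_pairs:
  "set (hits_pairs m s g k l acc) =
     {(x, y, z, w, s) | x y z w u. (u, x, y) \<in> set k \<and> (subm m g u, z, w) \<in> set l} \<union> set acc"
  by (induction m s g k l acc rule: hits_pairs.induct) (auto simp: set_hits)

lemma set_survivors:
  "set (survivors m ss k l acc) =
     {(x, y, z, w, s) | x y z w s u.
        s \<in> set ss \<and> (u, x, y) \<in> set k \<and> (subm m (twor m s) u, z, w) \<in> set l} \<union> set acc"
  by (induction m ss k l acc rule: survivors.induct) (auto simp: set_hits_pairs)

lemma refutes_all_iff: "refutes_all ls vs \<longleftrightarrow> (\<forall>v \<in> set vs. refutes ls v)"
  by (induction vs) auto

section \<open>Refinement of periods and soundness of the sieve\<close>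

fun mk_levels :: "nat \<Rightarrow> nat \<Rightarrow> (nat \<times> nat \<times> int) list \<Rightarrow> level list" where
  "mk_levels N M [] = []"
| "mk_levels N M ((q, r, m) # sp) =
     (map ((*) N) [0..<q], map ((*) M) [0..<r], m) # mk_levels (N * q) (M * r) sp"

fun periodic :: "nat \<Rightarrow> nat \<Rightarrow> (nat \<times> nat \<times> int) list \<Rightarrow> bool" where
  "periodic N M [] \<longleftrightarrow> True"
| "periodic N M ((q, r, m) # sp) \<longleftrightarrow> 0 < m \<and> 0 < N \<and> 0 < q \<and> 0 < M \<and> 0 < r \<and>
     fibr m (N * q) = 0 \<and> fibr m (N * q + 1) = 1 \<and> twor m (M * r) = twor m 0 \<and>
     periodic (N * q) (M * r) sp"

text \<open>Writing \<open>x\<close> as \<open>n + N * d\<close>, the remainder of \<open>d\<close>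
  modulo \<open>q\<close> selects the lift of the class of \<open>n\<close> that contains
  \<open>x\<close>.\<close>

lemma cong_shift:
  fixes x n N q :: nat
  assumes "[x = n] (mod N)" "0 < N" "0 < q"
  obtains n' where "n' \<in> set (shifts (map ((*) N) [0..<q]) n)" "[x = n'] (mod (N * q))"
proof -
  \<comment> \<open>The quotient is an integer because \<open>x\<close> may be smaller than
    \<open>n\<close>.\<close>
  define d where "d = (int x - int n) div int N"
  have d: "int x = int n + int N * d"
    using assms(1) by (simp add: d_def cong_int_iff[symmetric] cong_iff_dvd_diff)
  define j where "j = nat (d mod int q)"
  have j: "j < q" "int j = d mod int q"
    using \<open>0 < q\<close> by (simp_all add: j_def nat_less_iff)
  have "int x - int (n + N * j) = int N * (d - d mod int q)"
    using d j by (simp add: algebra_simps)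
  then have "int (N * q) dvd int x - int (n + N * j)"
    by (simp add: minus_mod_eq_mult_div)
  then have "[x = n + N * j] (mod (N * q))"
    by (simp add: cong_iff_dvd_diff flip: cong_int_iff)
  moreover have "n + N * j \<in> set (shifts (map ((*) N) [0..<q]) n)"
    unfolding set_shifts using j(1) by (intro imageI) auto
  ultimately show thesis by (rule that[rotated])
qed

text \<open>Induction over the levels: an actual tuple lies in some lift of its class. If it
  satisfies the equation modulo \<open>m\<close>, that lift is a survivor and is refuted by the
  remaining levels.\<close>

lemma refutes_sound:
  assumes "refutes (mk_levels N M sp) (n1, n2, n3, n4, a)" "periodic N M sp"
    and "[x1 = n1] (mod N)" "[x2 = n2] (mod N)" "[x3 = n3] (mod N)" "[x4 = n4] (mod N)" "[y = a] (mod M)"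
  shows "\<exists>m \<in> (\<lambda>(q, r, m). m) ` set sp.
    (fibr m x1 + fibr m x2 + fibr m x3 + fibr m x4) mod m \<noteq> twor m y"
  using assms
proof (induction sp arbitrary: N M n1 n2 n3 n4 a)
  case Nil
  then show ?case by simp
next
  case (Cons l sp)
  obtain q r m where l: "l = (q, r, m)" by (cases l)
  have per: "0 < m" "0 < N" "0 < q" "0 < M" "0 < r" "fibr m (N * q) = 0" "fibr m (N * q + 1) = 1"
    "twor m (M * r) = twor m 0" "periodic (N * q) (M * r) sp"
    using Cons.prems(2) by (simp_all add: l)
  let ?S = "\<lambda>n. set (shifts (map ((*) N) [0..<q]) n)"
  obtain k1 where k1: "k1 \<in> ?S n1" "[x1 = k1] (mod (N * q))"
    using cong_shift Cons.prems(3) per by blast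
  obtain k2 where k2: "k2 \<in> ?S n2" "[x2 = k2] (mod (N * q))"
    using cong_shift Cons.prems(4) per by blast
  obtain k3 where k3: "k3 \<in> ?S n3" "[x3 = k3] (mod (N * q))"
    using cong_shift Cons.prems(5) per by blast
  obtain k4 where k4: "k4 \<in> ?S n4" "[x4 = k4] (mod (N * q))"
    using cong_shift Cons.prems(6) per by blast
  obtain b where b: "b \<in> set (shifts (map ((*) M) [0..<r]) a)" "[y = b] (mod (M * r))"
    using cong_shift Cons.prems(7) per by blast
  have eq: "fibr m x1 = fibr m k1" "fibr m x2 = fibr m k2" "fibr m x3 = fibr m k3" "fibr m x4 = fibr m k4"
    "twor m y = twor m b"
    using fibr_cong[OF per(6,7)] twor_cong[OF per(8)] k1 k2 k3 k4 b by blast+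
  show ?case
  proof (cases "(fibr m x1 + fibr m x2 + fibr m x3 + fibr m x4) mod m = twor m y")
    case False
    then show ?thesis by (force simp: l)
  next
    case True
    have sums: "addm m (fibr m i) (fibr m j) = (fibr m i + fibr m j) mod m" for i j
      using addm_mod[OF per(1)] by (simp add: fibr_def mod_add_eq)
    \<comment> \<open>The first pair is moved to the other side: this equality is the match that
      \<open>hits\<close> looks for.\<close>
    have "subm m (twor m b) (addm m (fibr m k1) (fibr m k2)) = (twor m b - (fibr m k1 + fibr m k2)) mod m"
      using subm_mod[OF per(1), of "twor m b"] by (simp add: sums twor_def)
    also have "\<dots> = ((fibr m k1 + fibr m k2 + fibr m k3 + fibr m k4) mod m - (fibr m k1 + fibr m k2)) mod m"
      using True eq by simp
    also have "\<dots> = addm m (fibr m k3) (fibr m k4)"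
      by (simp add: sums mod_diff_left_eq algebra_simps)
    finally have "(k1, k2, k3, k4, b) \<in> set (survivors m (shifts (map ((*) M) [0..<r]) a)
       (pair_sums m (shifts (map ((*) N) [0..<q]) n1) (shifts (map ((*) N) [0..<q]) n2) [])
       (pair_sums m (shifts (map ((*) N) [0..<q]) n3) (shifts (map ((*) N) [0..<q]) n4) []) [])"
      using k1(1) k2(1) k3(1) k4(1) b(1) unfolding set_survivors set_pair_sums
      by (auto simp: image_iff intro!: exI bexI)
    then have "refutes (mk_levels (N * q) (M * r) sp) (k1, k2, k3, k4, b)"
      using Cons.prems(1) by (simp add: l refutes_all_iff)
    from Cons.IH[OF this per(9) k1(2) k2(2) k3(2) k4(2) b(2)] show ?thesis by (auto simp: l)
  qed
qed

lemma search_sound: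
  assumes "search ls k ns cs" "length zs = k" "f ` set zs \<subseteq> set cs"
  shows "\<exists>ys. mset ys = mset zs \<and> refutes_list ls (map f ys @ ns)"
  using assms
proof (induction ls k ns cs arbitrary: zs rule: search.induct)
  case (1 ls ns cs)
  then show ?case by simp
next
  case (2 ls k ns)
  then show ?case by (cases zs) auto
next
  case (3 ls k ns c cs)
  show ?case
  proof (cases "c \<in> f ` set zs")
    case True
    then obtain z where z: "z \<in> set zs" "f z = c" by auto
    have "length (remove1 z zs) = k" "f ` set (remove1 z zs) \<subseteq> set (c # cs)"
      using 3(4,5) z set_remove1_subset[of z zs] by (auto simp: length_remove1)
    then obtain ys where "mset ys = mset (remove1 z zs)" "refutes_list ls (map f ys @ c # ns)"
      using 3(1)[of "remove1 z zs"] 3(3) by (auto split: if_splits simp del: mset_remove1)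
    then have "mset (ys @ [z]) = mset zs" "refutes_list ls (map f (ys @ [z]) @ ns)"
      using z by auto
    then show ?thesis by blast
  next
    case False
    then show ?thesis using 3(2)[of zs] 3(3-5) by (auto split: if_splits)
  qed
qed


subsection \<open>Tables of residues\<close>

text \<open>Fast doubling along the binary digits of the index, carrying two consecutive Fibonacci
  residues.\<close>

fun fibp :: "int \<Rightarrow> num \<Rightarrow> int \<times> int" where
  "fibp m num.One = (1 mod m, 1 mod m)"
| "fibp m (num.Bit0 k) =
     (case fibp m k of (a, b) \<Rightarrow> (a * (2 * b - a) mod m, (a * a + b * b) mod m))"
| "fibp m (num.Bit1 k) =
     (case fibp m k of (a, b) \<Rightarrow> ((a * a + b * b) mod m, b * (2 * a + b) mod m))"

lemma fib_double:
  "int (fib (n + n)) = int (fib n) * (2 * int (fib (Suc n)) - int (fib n))"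
  "int (fib (Suc (n + n))) = int (fib n) * int (fib n) + int (fib (Suc n)) * int (fib (Suc n))"
proof -
  show "int (fib (n + n)) = int (fib n) * (2 * int (fib (Suc n)) - int (fib n))"
  proof (cases n)
    case (Suc k)
    have "fib (n + n) = fib (Suc (Suc k)) * fib (Suc k) + fib (Suc k) * fib k"
      using fib_add[of k "Suc k"] by (simp add: Suc)
    then show ?thesis by (simp add: Suc algebra_simps)
  qed simp
qed (simp add: fib_add)

lemma fibr_double:
  "fibr m (n + n) = fibr m n * (2 * fibr m (Suc n) - fibr m n) mod m"
  "fibr m (Suc (n + n)) = (fibr m n * fibr m n + fibr m (Suc n) * fibr m (Suc n)) mod m"
  "fibr m (Suc (Suc (n + n))) = fibr m (Suc n) * (2 * fibr m n + fibr m (Suc n)) mod m"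
proof -
  have fib: "[int (fib k) = fibr m k] (mod m)" for k
    by (simp add: fibr_def cong_def)
  have "[int (fib (n + n)) = fibr m n * (2 * fibr m (Suc n) - fibr m n)] (mod m)"
    unfolding fib_double by (intro cong_mult cong_diff cong_refl fib)
  then show "fibr m (n + n) = fibr m n * (2 * fibr m (Suc n) - fibr m n) mod m"
    by (simp only: fibr_def[of m "n + n"] cong_def)
  have "[int (fib (Suc (n + n))) = fibr m n * fibr m n + fibr m (Suc n) * fibr m (Suc n)] (mod m)"
    unfolding fib_double by (intro cong_mult cong_add fib)
  then show "fibr m (Suc (n + n)) = (fibr m n * fibr m n + fibr m (Suc n) * fibr m (Suc n)) mod m"
    by (simp only: fibr_def[of m "Suc (n + n)"] cong_def)
  have "int (fib (Suc (Suc (n + n)))) = int (fib (Suc n)) * (2 * int (fib n) + int (fib (Suc n)))"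
    by (simp add: fib_double algebra_simps)
  also have "[\<dots> = fibr m (Suc n) * (2 * fibr m n + fibr m (Suc n))] (mod m)"
    by (intro cong_mult cong_add cong_refl fib)
  finally show "fibr m (Suc (Suc (n + n))) = fibr m (Suc n) * (2 * fibr m n + fibr m (Suc n)) mod m"
    by (simp only: fibr_def[of m "Suc (Suc (n + n))"] cong_def)
qed

lemma fibp_correct: "fibp m k = (fibr m (numeral k), fibr m (Suc (numeral k)))"
proof (induction k)
  case One
  then show ?case by (simp add: fibr_def)
qed (simp_all only: fibp.simps prod.case numeral_Bit0 numeral_Bit1 fibr_double flip: Suc_eq_plus1)

fun twop :: "int \<Rightarrow> num \<Rightarrow> int" where
  "twop m num.One = 2 mod m"
| "twop m (num.Bit0 k) = (let a = twop m k in a * a mod m)"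
| "twop m (num.Bit1 k) = (let a = twop m k in 2 * (a * a mod m) mod m)"

lemma twop_correct: "twop m k = 2 ^ numeral k mod m"
proof (induction k)
  case (Bit0 k)
  have "twop m (num.Bit0 k) = 2 ^ (numeral k + numeral k) mod m"
    by (simp only: twop.simps Bit0 Let_def power_add mod_simps)
  then show ?case by (simp only: numeral_Bit0)
next
  case (Bit1 k)
  have "twop m (num.Bit1 k) = 2 * ((2 ^ numeral k mod m) * (2 ^ numeral k mod m) mod m) mod m"
    by (simp only: twop.simps Bit1 Let_def)
  also have "\<dots> = 2 ^ Suc (numeral k + numeral k) mod m"
    by (metis mod_mult_eq mod_mult_right_eq power_Suc power_add)
  finally show ?case by (simp only: numeral_Bit1 Suc_eq_plus1)
qed simp

text \<open>
  The residues needed by the search are tabulated in windows of consecutive arguments, so that only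
  the first entries of a window require modular exponentiation. Beyond index 240 the surviving
  index classes lie within 16 of multiples of 120.
\<close>

fun fib_window :: "int \<Rightarrow> nat \<Rightarrow> int \<Rightarrow> int \<Rightarrow> nat \<Rightarrow> bool" where
  "fib_window m n a b 0 = True"
| "fib_window m n a b (Suc k) = (fibr m n = a \<and> fib_window m (n + 1) b (addm m a b) k)"

fun two_window :: "int \<Rightarrow> nat \<Rightarrow> int \<Rightarrow> nat \<Rightarrow> bool" where
  "two_window m n a 0 = True"
| "two_window m n a (Suc k) = (twor m n = a \<and> two_window m (n + 1) (addm m a a) k)"

lemma fib_windowI:
  "fibr m n = a \<Longrightarrow> fibr m (n + 1) = b \<Longrightarrow> 0 < m \<Longrightarrow> fib_window m n a b k"
proof (induction k arbitrary: n a b)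
  case (Suc k)
  have "fibr m (n + 1 + 1) = addm m a b"
    using addm_mod[OF Suc.prems(3), of "int (fib n)" "int (fib (n + 1))"] Suc.prems(1,2)
    by (simp add: fibr_def add.commute)
  then show ?case using Suc by simp
qed simp

lemma two_windowI:
  "twor m n = a \<Longrightarrow> 0 < m \<Longrightarrow> two_window m n a k"
proof (induction k arbitrary: n a)
  case (Suc k)
  have "twor m (n + 1) = addm m a a"
    using addm_mod[OF Suc.prems(2), of "2 ^ (n + 11)" "2 ^ (n + 11)"] Suc.prems(1)
    unfolding twor_def by (simp add: power_add)
  then have "two_window m (n + 1) (addm m a a) k"
    using Suc.IH Suc.prems(2) by blast
  then show ?case using Suc.prems(1) by simp
qed simp

text \<open>The forms \<open>Bit0\<close> and \<open>Bit1\<close> exclude the modulus 1, for which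
  \<open>fibr m 1\<close> would be 0.\<close>

lemma fib_window_0: "fib_window (numeral (num.Bit0 m)) 0 0 1 k" "fib_window (numeral (num.Bit1 m)) 0 0 1 k"
  by (rule fib_windowI; simp add: fibr_def)+

lemma fib_window_numeral:
  "fibp (numeral m) n = (a, b) \<Longrightarrow> fib_window (numeral m) (numeral n) a b k"
  by (rule fib_windowI) (simp_all add: fibp_correct)

lemma two_window_0: "2048 mod numeral m = a \<Longrightarrow> two_window (numeral m) 0 a k"
  by (rule two_windowI) (simp_all add: twor_def)

lemma two_window_numeral:
  "2048 * twop (numeral m) n mod numeral m = a \<Longrightarrow> two_window (numeral m) (numeral n) a k"
proof (rule two_windowI)
  have "twor m n = 2048 * (2 ^ n mod m) mod m" for m n
    by (simp add: twor_def power_add mod_simps mult_ac)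
  then show "twor (numeral m) (numeral n) = a" if "2048 * twop (numeral m) n mod numeral m = a"
    using that by (simp only: twop_correct)
qed simp_all

lemma fib_windows_0:
  "fib_window 11 0 0 1 9" "fib_window 124 0 0 1 29" "fib_window 40 0 0 1 59"
  "fib_window 61 0 0 1 59" "fib_window 5904 0 0 1 119" "fib_window 53984 0 0 1 239"
  "fib_window 64 0 0 1 17" "fib_window 1601 0 0 1 17" "fib_window 128 0 0 1 17"
  "fib_window 769 0 0 1 17" "fib_window 164096 0 0 1 17" "fib_window 512 0 0 1 17"
  "fib_window 7681 0 0 1 17" "fib_window 1689601 0 0 1 17" "fib_window 2048 0 0 1 17"
  by (rule fib_window_0)+

text \<open>The windows of length 2 with entries 0 and 1 lie at the index period reached when the
  modulus is used, and certify that period.\<close>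

lemma fib_windows:
  "fib_window 11 10 0 1 2" "fib_window 124 30 0 1 2" "fib_window 40 60 0 1 2"
  "fib_window 61 60 0 1 2" "fib_window 5904 120 0 1 2" "fib_window 53984 240 0 1 2"
  "fib_window 64 120 32 17 1" "fib_window 64 225 34 39 32" "fib_window 64 360 32 49 1"
  "fib_window 64 465 34 7 14" "fib_window 64 480 0 1 2" "fib_window 1601 120 164 82 1"
  "fib_window 1601 225 991 377 32" "fib_window 1601 360 1437 1519 1"
  "fib_window 1601 465 610 1224 14" "fib_window 1601 480 0 1 2" "fib_window 128 225 98 103 32"
  "fib_window 128 465 98 71 32" "fib_window 128 705 98 39 32" "fib_window 128 945 98 7 14"
  "fib_window 128 960 0 1 2" "fib_window 769 225 251 752 32" "fib_window 769 465 159 377 32"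
  "fib_window 769 705 518 17 32" "fib_window 769 945 610 392 14" "fib_window 769 960 0 1 2"
  "fib_window 164096 240 30784 117665 1" "fib_window 164096 465 131682 81991 32"
  "fib_window 164096 720 112832 119521 1" "fib_window 164096 945 125026 91399 32"
  "fib_window 164096 1200 51264 6689 1" "fib_window 164096 1425 158050 91079 32"
  "fib_window 164096 1680 133312 86881 1" "fib_window 164096 1905 610 163719 14"
  "fib_window 164096 1920 0 1 2" "fib_window 512 960 256 129 1" "fib_window 512 1905 98 391 32"
  "fib_window 512 2880 256 385 1" "fib_window 512 3825 98 135 14" "fib_window 512 3840 0 1 2"
  "fib_window 7681 960 5250 1056 1" "fib_window 7681 1905 3501 6300 32"
  "fib_window 7681 2880 5250 4194 1" "fib_window 7681 3825 7071 377 32"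
  "fib_window 7681 4800 2431 6625 1" "fib_window 7681 5745 4180 1381 32"
  "fib_window 7681 6720 2431 3487 1" "fib_window 7681 7665 610 7304 14"
  "fib_window 7681 7680 0 1 2" "fib_window 1689601 1926 417439 1340419 11"
  "fib_window 1689601 3825 1198949 778905 32" "fib_window 1689601 5766 550208 500168 11"
  "fib_window 1689601 7665 1688991 377 32" "fib_window 1689601 9606 1272162 349182 11"
  "fib_window 1689601 11505 490652 910696 32" "fib_window 1689601 13446 1139393 1189433 11"
  "fib_window 1689601 15345 610 1689224 14" "fib_window 1689601 15360 0 1 2"
  "fib_window 2048 7665 610 647 32" "fib_window 2048 15345 610 1671 14"
  "fib_window 2048 15360 0 1 2"
  by (rule fib_window_numeral, code_simp)+

lemma two_windows_0:
  "two_window 11 0 2 10" "two_window 124 0 64 10" "two_window 40 0 8 20" "two_window 61 0 35 60"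
  "two_window 5904 0 2048 1" "two_window 53984 0 2048 1" "two_window 64 0 0 1"
  "two_window 1601 0 447 1" "two_window 128 0 0 1" "two_window 769 0 510 1"
  "two_window 164096 0 2048 1" "two_window 512 0 0 1" "two_window 7681 0 2048 1"
  "two_window 1689601 0 2048 1" "two_window 2048 0 0 1"
  by (rule two_window_0, simp)+

text \<open>For each modulus the last window lies at the exponent period reached there and repeats
  the entry at 0.\<close>

lemma two_windows:
  "two_window 11 10 2 1" "two_window 124 10 64 1" "two_window 40 20 8 1" "two_window 61 60 35 1"
  "two_window 5904 12 4928 1" "two_window 5904 22 4256 8" "two_window 5904 42 320 1"
  "two_window 5904 52 2960 8" "two_window 5904 60 2048 1" "two_window 53984 22 512 2"
  "two_window 53984 52 32768 8" "two_window 53984 82 45760 2" "two_window 53984 112 13504 8"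
  "two_window 53984 120 2048 1" "two_window 64 114 0 6" "two_window 64 120 0 1"
  "two_window 1601 114 257 6" "two_window 1601 234 413 6" "two_window 1601 354 265 6"
  "two_window 1601 474 77 6" "two_window 1601 594 1569 6" "two_window 1601 714 1344 6"
  "two_window 1601 834 1188 6" "two_window 1601 954 1336 6" "two_window 1601 1074 1524 6"
  "two_window 1601 1194 32 6" "two_window 1601 1200 447 1" "two_window 128 595 0 5"
  "two_window 128 1195 0 5" "two_window 128 1200 0 1" "two_window 769 595 572 5"
  "two_window 769 1195 306 5" "two_window 769 1795 524 5" "two_window 769 2395 646 5"
  "two_window 769 2995 679 5" "two_window 769 3595 253 5" "two_window 769 4195 579 5"
  "two_window 769 4795 705 5" "two_window 769 5395 197 5" "two_window 769 5995 463 5"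
  "two_window 769 6595 245 5" "two_window 769 7195 123 5" "two_window 769 7795 90 5"
  "two_window 769 8395 516 5" "two_window 769 8995 190 5" "two_window 769 9595 64 5"
  "two_window 769 9600 510 1" "two_window 164096 4796 82176 4" "two_window 164096 9596 82176 4"
  "two_window 164096 9600 2048 1" "two_window 512 9597 0 3" "two_window 512 19197 0 3"
  "two_window 512 19200 0 1" "two_window 7681 9597 7425 3" "two_window 7681 19197 256 3"
  "two_window 7681 19200 2048 1" "two_window 1689601 9598 1162171 2"
  "two_window 1689601 19198 1689089 2" "two_window 1689601 28798 527430 2"
  "two_window 1689601 38398 512 2" "two_window 1689601 38400 2048 1" "two_window 2048 19198 0 2"
  "two_window 2048 38398 0 2" "two_window 2048 38400 0 1"
  by (rule two_window_numeral, code_simp)+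

text \<open>Unfolding entry by entry turns the window facts into individual rewrite rules for
  \<open>fibr\<close> and \<open>twor\<close>.\<close>

lemma window_numeral:
  "fib_window m n a b (numeral k) \<longleftrightarrow> fibr m n = a \<and> fib_window m (n + 1) b (addm m a b) (pred_numeral k)"
  "two_window m n a (numeral k) \<longleftrightarrow> twor m n = a \<and> two_window m (n + 1) (addm m a a) (pred_numeral k)"
  by (simp_all add: numeral_eq_Suc)

lemma window_1:
  "fib_window m n a b 1 \<longleftrightarrow> fibr m n = a" "two_window m n a 1 \<longleftrightarrow> twor m n = a"
  by simp_all

text \<open>Ground rules are enough for the search, which only adds, subtracts and compares
  numerals.\<close>

lemmas arith = arith_simps rel_simps if_True if_False add_0_left add_0_right diff_0_right arith_special
  zero_neq_numeral numeral_neq_zero one_eq_numeral_iff numeral_eq_one_iff zero_neq_one one_neq_zero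
  refl zero_le_numeral not_numeral_le_zero zero_less_numeral not_numeral_less_zero order_refl
  less_irrefl zero_le_one not_one_le_zero zero_less_one not_one_less_zero simp_thms
  pred_numeral_simps addm_def subm_def

lemmas fib_table_0 = fib_windows_0[simplified window_numeral window_1 arith]
lemmas fib_table = fib_windows[simplified window_numeral window_1 arith]
lemmas two_table_0 = two_windows_0[simplified window_numeral window_1 arith]
lemmas two_table = two_windows[simplified window_numeral window_1 arith]

lemmas search_eval =
  fib_table_0 fib_table two_table_0 two_table arith search.simps refutes_list.simps
  refutes.simps refutes_all.simps survivors.simps hits_pairs.simps hits.simps pair_sums.simps
  sums_with.simps shifts.simps

text \<open>
  A triple $(q, r, m)$ multiplies the index period by $q$ and the exponent period by $r$ and then
  tests modulo $m$. The odd parts of the moduli are products of 9 and of primes for which both the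
  Fibonacci period and the order of 2 are smooth; the powers of 2 go up to $2^{11}$ because the
  indices of the genuine solutions with value at most 1024 survive every other modulus.
\<close>

definition spec :: "(nat \<times> nat \<times> int) list" where
  "spec =
    [(1, 10, 11), (3, 1, 124), (2, 2, 40), (1, 3, 61), (2, 1, 5904), (2, 2, 53984),
     (2, 1, 64), (1, 10, 1601), (2, 1, 128), (1, 8, 769), (2, 1, 164096), (2, 2, 512),
     (2, 1, 7681), (2, 2, 1689601), (1, 1, 2048)]"

text \<open>The lifts are made explicit before the search runs. Higher powers of 2 become available
  as the index period doubles, since modulo \<open>2 ^ k\<close> the Fibonacci period is
  \<open>3 * 2 ^ (k - 1)\<close>.\<close>

lemma levels:
  "mk_levels 10 1 spec =
   [([0], [0, 1, 2, 3, 4, 5, 6, 7, 8, 9], 11),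
    ([0, 10, 20], [0], 124),
    ([0, 30], [0, 10], 40),
    ([0], [0, 20, 40], 61),
    ([0, 60], [0], 5904),
    ([0, 120], [0, 60], 53984),
    ([0, 240], [0], 64),
    ([0], [0, 120, 240, 360, 480, 600, 720, 840, 960, 1080], 1601),
    ([0, 480], [0], 128),
    ([0], [0, 1200, 2400, 3600, 4800, 6000, 7200, 8400], 769),
    ([0, 960], [0], 164096),
    ([0, 1920], [0, 9600], 512),
    ([0, 3840], [0], 7681),
    ([0, 7680], [0, 19200], 1689601),
    ([0], [0], 2048)]"
  by (simp add: spec_def upt_conv_Cons)

lemma periodic_spec: "periodic 10 1 spec"
  by (simp only: spec_def periodic.simps arith fib_table_0 fib_table two_table_0 two_table mult_1_left mult_1_right)

text \<open>The computational core. The rule \<open>if_weak_cong\<close> keeps a branch from being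
  rewritten before its condition is decided.\<close>

lemma search: "search (mk_levels 10 1 spec) (Suc (Suc (Suc (Suc 0)))) [] [0, 2, 4, 6, 8, 1, 3, 5]"
  unfolding levels by (simp only: search_eval cong: if_weak_cong)

subsection \<open>Powers of two with few Zeckendorf digits\<close>

text \<open>The successive index periods divide one another, so the last one is a common period of
  all moduli.\<close>

lemma periodic_moduli:
  assumes "periodic N M sp" "(q, r, m) \<in> set sp"
  shows "\<exists>N'. fibr m N' = 0 \<and> fibr m (N' + 1) = 1 \<and> N' dvd N * (\<Prod>(q, r, m) \<leftarrow> sp. q)"
  using assms
proof (induction N M sp rule: periodic.induct)
  case (2 N M q' r' m' sp)
  have "N * q' dvd N * (\<Prod>(q, r, m) \<leftarrow> (q', r', m') # sp. q)" by simp
  then show ?case using 2 by (force simp: mult.assoc)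
qed simp

text \<open>
  Since $F_{-n} = F_n$ for odd $n$, the odd index classes 7 and 9 modulo 10 may be replaced by
  3 and 1. This shrinks the search.
\<close>

lemma fibr_representative:
  assumes "\<And>m. m \<in> S \<Longrightarrow> fibr m K = 0 \<and> fibr m (K + 1) = 1" "10 dvd K" "0 < K"
  shows "\<exists>x'. x' mod 10 \<in> {0, 2, 4, 6, 8, 1, 3, 5} \<and> (\<forall>m \<in> S. fibr m x' = fibr m x)"
proof (cases "x mod 10 \<in> {0, 2, 4, 6, 8, 1, 3, 5}")
  case True
  then show ?thesis by (intro exI[of _ x]) simp
next
  case False
  then have x: "x mod 10 = 7 \<or> x mod 10 = 9" by (simp, presburger)
  then have "odd x" by presburger
  \<comment> \<open>Since 10 divides \<open>K\<close>, passing to \<open>(K - 1) * x\<close> also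
    negates the residue modulo 10, sending 7 to 3 and 9 to 1.\<close>
  have "(K - 1) * x + x = K * x" using \<open>0 < K\<close> by (cases K) auto
  then have "[(K - 1) * x + x = 0] (mod 10)" using \<open>10 dvd K\<close> by (simp add: cong_0_iff)
  then have "((K - 1) * x) mod 10 \<in> {1, 3}" using x unfolding cong_def by (simp, presburger)
  moreover have "fibr m ((K - 1) * x) = fibr m x" if "m \<in> S" for m
    using fibr_reflect \<open>0 < K\<close> \<open>odd x\<close> assms(1)[OF that] by blast
  ultimately show ?thesis by (intro exI[of _ "(K - 1) * x"]) auto
qed

text \<open>After reflecting indices into the searched classes and permuting them, the sieve yields
  a modulus for which the supposed equation fails.\<close>

lemma four_fib_ne_power_of_2: "fib x1 + fib x2 + fib x3 + fib x4 \<noteq> 2 ^ (y + 11)"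
proof
  assume sum: "fib x1 + fib x2 + fib x3 + fib x4 = 2 ^ (y + 11)"
  define S where "S = (\<lambda>(q, r, m). m) ` set spec"
  have per: "fibr m 15360 = 0 \<and> fibr m (15360 + 1) = 1" if "m \<in> S" for m
  proof -
    obtain q r where "(q, r, m) \<in> set spec" using \<open>m \<in> S\<close> by (auto simp: S_def)
    moreover have "10 * (\<Prod>(q, r, m) \<leftarrow> spec. q) = 15360" by (simp add: spec_def)
    ultimately obtain N where N: "fibr m N = 0" "fibr m (N + 1) = 1" "N dvd 15360"
      using periodic_moduli[OF periodic_spec] by metis
    have "[15360 = 0] (mod N)" using N(3) by (simp add: cong_0_iff)
    then have "fibr m 15360 = fibr m 0" "fibr m (15360 + 1) = fibr m (0 + 1)"
      using fibr_cong[OF N(1,2)] cong_add[OF _ cong_refl] by blast+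
    moreover have "fibr m 0 = 0" by (simp add: fibr_def)
    moreover have "fibr m (0 + 1) = 1"
      using fibr_period[OF N(1,2), of 1] N(2) by simp
    ultimately show ?thesis by simp
  qed
  \<comment> \<open>One representative must serve all moduli at once, because the sieve follows the
    same index through every level; the common period 15360 makes this possible.\<close>
  have "\<exists>x'. x' mod 10 \<in> {0, 2, 4, 6, 8, 1, 3, 5} \<and> (\<forall>m \<in> S. fibr m x' = fibr m x)" for x
    by (rule fibr_representative[OF per]) simp_all
  then obtain h where h: "\<And>x. h x mod 10 \<in> {0, 2, 4, 6, 8, 1, 3, 5}"
      "\<And>x m. m \<in> S \<Longrightarrow> fibr m (h x) = fibr m x"
    by metis
  have "\<exists>ys. mset ys = mset [x1, x2, x3, x4] \<and>
      refutes_list (mk_levels 10 1 spec) (map (\<lambda>x. h x mod 10) ys @ [])"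
    by (rule search_sound[OF search]) (use h(1) in auto)
  then obtain ys where ys: "mset ys = mset [x1, x2, x3, x4]"
      "refutes_list (mk_levels 10 1 spec) (map (\<lambda>x. h x mod 10) ys)" by auto
  have "length ys = length [x1, x2, x3, x4]" using ys(1) by (rule mset_eq_length)
  then obtain y1 y2 y3 y4 where y: "ys = [y1, y2, y3, y4]"
    by (auto simp: length_Suc_conv)
  have "refutes (mk_levels 10 1 spec) (h y1 mod 10, h y2 mod 10, h y3 mod 10, h y4 mod 10, 0)"
    using ys(2) by (simp add: y)
  then have "\<exists>m \<in> S. (fibr m (h y1) + fibr m (h y2) + fibr m (h y3) + fibr m (h y4)) mod m \<noteq> twor m y"
    unfolding S_def by (rule refutes_sound[OF _ periodic_spec]) (simp_all add: cong_def)
  then obtain m where m: "m \<in> S"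
      "(fibr m (h y1) + fibr m (h y2) + fibr m (h y3) + fibr m (h y4)) mod m \<noteq> twor m y" by blast
  have "[fibr m y1 + fibr m y2 + fibr m y3 + fibr m y4
      = int (fib y1) + int (fib y2) + int (fib y3) + int (fib y4)] (mod m)"
    by (intro cong_add) (simp_all add: fibr_def cong_def)
  then have "(fibr m y1 + fibr m y2 + fibr m y3 + fibr m y4) mod m
      = int (fib y1 + fib y2 + fib y3 + fib y4) mod m"
    by (simp add: cong_def)
  \<comment> \<open>The sum depends only on the multiset of indices, which undoes the
    permutation.\<close>
  also have "fib y1 + fib y2 + fib y3 + fib y4 = sum_mset (image_mset fib (mset ys))"
    by (simp add: y)
  also have "\<dots> = 2 ^ (y + 11)" using sum by (simp add: ys(1))
  finally show False using m h(2) by (simp add: twor_def)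
qed

section \<open>The remaining exponents up to 10 and the conclusion\<close>

lemma zeckendorf_small:
  "zeckendorf (Suc 0) = [0]" "zeckendorf 2 = [1]" "zeckendorf 4 = [2, 0]" "zeckendorf 8 = [4]"
  "zeckendorf 16 = [5, 2]" "zeckendorf 32 = [6, 4, 2]" "zeckendorf 64 = [8, 4, 0]"
  "zeckendorf 128 = [9, 7, 3]" "zeckendorf 256 = [11, 6, 1]"
  "zeckendorf 512 = [12, 9, 7, 4, 2, 0]" "zeckendorf 1024 = [14, 7, 2]"
  by (simp_all add: zeckendorf_eq_iff is_zeckendorf_def F_rec F_0 F_1[unfolded One_nat_def])

text \<open>The sieve bounds \<open>m\<close> by 10; among the expansions listed above none has four
  entries and exactly five have three.\<close>

lemma zeckendorf_digits_power_of_2: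
  assumes "zeckendorf_digits (2 ^ m) \<in> {3, 4}"
  shows "m \<in> {5, 6, 7, 8, 10}" "zeckendorf_digits (2 ^ m) = 3"
proof -
  obtain ns where ns: "zeckendorf (2 ^ m) = ns" by blast
  then have sum: "(2::nat) ^ m = (\<Sum>i\<leftarrow>ns. fib (i + 2))"
    unfolding zeckendorf_eq_iff by (simp add: is_zeckendorf_def F_def)
  have "length ns = 3 \<or> length ns = 4"
    using assms by (simp add: zeckendorf_digits_def ns)
  then obtain x1 x2 x3 x4 where "fib x1 + fib x2 + fib x3 + fib x4 = 2 ^ m"
  proof
    assume "length ns = 3"
    then obtain a b c where "ns = [a, b, c]" by (auto simp: numeral_3_eq_3 length_Suc_conv)
    \<comment> \<open>The final index 0 pads the sum with \<open>fib 0 = 0\<close>; the shifts by 2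
      come from \<open>F\<close>.\<close>
    then show ?thesis using that[of "a + 2" "b + 2" "c + 2" 0] sum by simp
  next
    assume "length ns = 4"
    then obtain a b c d where "ns = [a, b, c, d]"
      by (auto simp: eval_nat_numeral length_Suc_conv)
    then show ?thesis using that[of "a + 2" "b + 2" "c + 2" "d + 2"] sum by simp
  qed
  then have "\<not> 11 \<le> m" using four_fib_ne_power_of_2 by (metis le_add_diff_inverse2)
  then have "m = 0 \<or> m = 1 \<or> m = 2 \<or> m = 3 \<or> m = 4 \<or> m = 5 \<or> m = 6 \<or> m = 7 \<or> m = 8 \<or> m = 9 \<or> m = 10"
    by presburger
  then show "m \<in> {5, 6, 7, 8, 10}" "zeckendorf_digits (2 ^ m) = 3"
    using assms by (auto simp: zeckendorf_digits_def zeckendorf_small)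
qed

theorem theorem6:
  "{n :: nat. (\<exists>m :: nat. n = 2 ^ m) \<and> zeckendorf_digits n = 3} = {32, 64, 128, 256, 1024} \<and>
   \<not> (\<exists>m :: nat. zeckendorf_digits (2 ^ m) = 4)"
proof
  have pow: "32 = (2::nat) ^ 5" "64 = (2::nat) ^ 6" "128 = (2::nat) ^ 7" "256 = (2::nat) ^ 8"
      "1024 = (2::nat) ^ 10" by simp_all
  show "{n :: nat. (\<exists>m :: nat. n = 2 ^ m) \<and> zeckendorf_digits n = 3} = {32, 64, 128, 256, 1024}"
  proof (intro equalityI subsetI)
    fix n :: nat assume "n \<in> {n. (\<exists>m :: nat. n = 2 ^ m) \<and> zeckendorf_digits n = 3}"
    then obtain m where "n = 2 ^ m" "zeckendorf_digits (2 ^ m) = 3" by auto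
    then show "n \<in> {32, 64, 128, 256, 1024}"
      using zeckendorf_digits_power_of_2(1)[of m] by auto
  next
    fix n :: nat assume n: "n \<in> {32, 64, 128, 256, 1024}"
    then have "\<exists>m. n = 2 ^ m" using pow by blast
    moreover have "zeckendorf_digits n = 3"
      using n by (auto simp: zeckendorf_digits_def zeckendorf_small)
    ultimately show "n \<in> {n. (\<exists>m :: nat. n = 2 ^ m) \<and> zeckendorf_digits n = 3}" by simp
  qed
next
  show "\<not> (\<exists>m :: nat. zeckendorf_digits (2 ^ m) = 4)"
    using zeckendorf_digits_power_of_2(2) by fastforce
qed

end
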